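(* The sequences $\{SOME(2n)\}_{n\ge 1}$ and $\{SOME(2n-1)\}_{n\ge 1}$ are monotonically increasing (in the weak sense, i.e. each term is greater than or equal to the preceding one).
   Context: A partition of a positive integer $n$ is a non-increasing finite sequence of positive integers (its parts) with sum $n$. $SOME(n)$ is the sum of all odd parts in all partitions of $n$ minus the sum of all even parts in all partitions of $n$ (parts counted with multiplicity). *)

theory Defs
  imports Main
begin

definition partitions :: "nat \<Rightarrow> nat list set" where
  "partitions n = {p. sorted_wrt (\<ge>) p \<and> (\<forall>x\<in>set p. 0 < x) \<and> sum_list p = n}"

(* Hence the sums over partitions below are genuine. *)
lemma finite_partitions: "finite (partitions n)"
proof (rule finite_subset)
  have len: "length p \<le> sum_list p" if "\<forall>x\<in>set p. 0 < x" for p :: "nat list"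
    using that by (induction p) auto
  show "partitions n \<subseteq> {p. set p \<subseteq> {..n} \<and> length p \<le> n}"
    unfolding partitions_def using len member_le_sum_list by fastforce
  show "finite {p. set p \<subseteq> {..n} \<and> length p \<le> n}"
    by (rule finite_lists_length_le) simp
qed

(* SOME (Sum of Odd Minus Even) is renamed, since SOME is reserved syntax.
   The values are integers because truncated subtraction on nat would be wrong. *)
definition some_parts :: "nat \<Rightarrow> int" where
  "some_parts n =
     int (\<Sum>p\<in>partitions n. sum_list (filter odd p)) -
     int (\<Sum>p\<in>partitions n. sum_list (filter even p))"

end

theory Submission
  imports Defs "HOL-Computational_Algebra.Formal_Power_Series"
begin

unbundle fps_syntax

(* With P(q) = prod (1 - q^(2s)) / (1 - q^(2s-1)), the generating function of SOME is
   sum_k (-1)^(k+1) k q^k / (1 - q^k) * prod 1 / (1 - q^k): the first factor is q P'(q) / P(q)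
   and the second one is P(q) / prod (1 - q^(2s))^2, so the product is q P'(q) / prod (1 - q^(2s))^2.
   By Gauss, P(q) = sum_t q^(t(t+1)/2), hence q P'(q) has nonnegative coefficients; the
   remaining factor contains 1 / (1 - q^2), which makes the coefficients increase in steps of two.
   All products are truncated at n, which does not affect the coefficients up to q^(2n).
   Gauss' identity is obtained from Shanks' finite form (Proc. AMS 2, 1951). *)

subsection \<open>Series with nonnegative coefficients\<close>

definition nonneg_fps :: "real fps \<Rightarrow> bool" where
  "nonneg_fps f \<longleftrightarrow> (\<forall>n. 0 \<le> f $ n)"

lemma nonneg_fps_mult: "nonneg_fps f \<Longrightarrow> nonneg_fps g \<Longrightarrow> nonneg_fps (f * g)"
  unfolding nonneg_fps_def fps_mult_nth by (auto intro!: sum_nonneg)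

lemma nonneg_fps_prod: "(\<And>x. x \<in> A \<Longrightarrow> nonneg_fps (f x)) \<Longrightarrow> nonneg_fps (prod f A)"
proof (induction A rule: infinite_finite_induct)
  case (insert x A)
  then show ?case by (simp add: nonneg_fps_mult)
qed (auto simp: nonneg_fps_def fps_one_nth)

lemma inverse_one_minus_X_power:
  "0 < k \<Longrightarrow> (1 - fps_X ^ k) * inverse (1 - fps_X ^ k) = (1 :: real fps)"
  by (subst mult.commute, rule inverse_mult_eq_1) (simp add: fps_X_power_nth)

text \<open>The inverse is the geometric series in \<open>fps_X ^ k\<close>, whose coefficients are
  the indicator of the multiples of \<open>k\<close>.\<close>

lemma nonneg_fps_inverse_one_minus_X_power:
  assumes "0 < k"
  shows "nonneg_fps (inverse (1 - fps_X ^ k))"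
proof -
  let ?g = "Abs_fps (\<lambda>n. if k dvd n then 1 else 0) :: real fps"
  have "(1 - fps_X ^ k) * ?g = 1"
  proof (rule fps_ext)
    fix n
    show "((1 - fps_X ^ k) * ?g) $ n = 1 $ n"
      using assms
      by (auto simp: left_diff_distrib fps_X_power_mult_nth fps_one_nth dvd_minus_self
          dest: dvd_imp_le)
  qed
  then have "inverse (1 - fps_X ^ k) = ?g"
    by (rule fps_inverse_unique)
  then show ?thesis by (simp add: nonneg_fps_def)
qed

subsection \<open>Gauss' triangular number identity\<close>

definition gauss_prod :: "nat \<Rightarrow> real fps" where
  "gauss_prod n = (\<Prod>s<n. (1 - fps_X ^ (2 * s + 2)) * inverse (1 - fps_X ^ (2 * s + 1)))"

lemma gauss_prod_0 [simp]: "gauss_prod 0 = 1"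
  by (simp add: gauss_prod_def)

lemma gauss_prod_Suc:
  "gauss_prod (Suc n) =
     gauss_prod n * ((1 - fps_X ^ (2 * n + 2)) * inverse (1 - fps_X ^ (2 * n + 1)))"
  unfolding gauss_prod_def by (rule prod.lessThan_Suc)

lemma gauss_prod_Suc_mult:
  "(1 - fps_X ^ (2 * n + 1)) * gauss_prod (Suc n) = (1 - fps_X ^ (2 * n + 2)) * gauss_prod n"
proof -
  have "(1 - fps_X ^ (2 * n + 1)) * gauss_prod (Suc n) =
      ((1 - fps_X ^ (2 * n + 1)) * inverse (1 - fps_X ^ (2 * n + 1))) *
      ((1 - fps_X ^ (2 * n + 2)) * gauss_prod n)"
    unfolding gauss_prod_Suc by (simp only: mult_ac)
  then show ?thesis by (subst (asm) inverse_one_minus_X_power) simp_all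
qed

lemma gauss_prod_nth_0 [simp]: "gauss_prod n $ 0 = 1"
  by (induction n) (simp_all add: gauss_prod_Suc)

lemma gauss_prod_inverse: "gauss_prod n * inverse (gauss_prod n) = 1"
  by (subst mult.commute, rule inverse_mult_eq_1) simp

text \<open>The recurrence for the reciprocals, again free of quotients; it rewrites the boundary
  term of the telescoping sum below.\<close>

lemma inverse_gauss_prod_Suc:
  "(1 - fps_X ^ (2 * n + 2)) * inverse (gauss_prod (Suc n)) =
   (1 - fps_X ^ (2 * n + 1)) * inverse (gauss_prod n)"
proof -
  have "(1 - fps_X ^ (2 * n + 2)) * inverse (gauss_prod (Suc n)) =
      ((1 - fps_X ^ (2 * n + 2)) * gauss_prod n) * inverse (gauss_prod n) * inverse (gauss_prod (Suc n))"
    using gauss_prod_inverse[of n] by (simp add: mult_ac)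
  also have "\<dots> = (1 - fps_X ^ (2 * n + 1)) * inverse (gauss_prod n) *
      (gauss_prod (Suc n) * inverse (gauss_prod (Suc n)))"
    unfolding gauss_prod_Suc_mult[symmetric] by (simp only: mult_ac)
  finally show ?thesis by (simp add: gauss_prod_inverse)
qed

text \<open>The summand compares the s-th terms of Shanks' sum for \<open>Suc n\<close> and for
  \<open>n\<close>. The right side is its antidifference in \<open>m\<close>; it vanishes at
  \<open>m = 0\<close> through the factor \<open>1 - fps_X ^ (2 * m)\<close>.\<close>

lemma shanks_telescope:
  "(\<Sum>s<m. gauss_prod (Suc n) * inverse (gauss_prod s) * fps_X ^ (s * (2 * n + 3)) -
          gauss_prod n * inverse (gauss_prod s) * fps_X ^ (s * (2 * n + 1))) =
   gauss_prod n * inverse (1 - fps_X ^ (2 * n + 1)) *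
     (fps_X ^ (m * (2 * n + 1)) * ((1 - fps_X ^ (2 * m)) * inverse (gauss_prod m)))"
proof (induction m)
  case (Suc m)
  define I :: "real fps" where "I = inverse (1 - fps_X ^ (2 * n + 1))"
  define R where "R = inverse (gauss_prod m)"
  define x y z :: "real fps" where
    "x = fps_X ^ (m * (2 * n + 1))" and "y = fps_X ^ (2 * m)" and "z = fps_X ^ (2 * n + 1)"
  have pw: "fps_X ^ (m * (2 * n + 3)) = x * y" "fps_X ^ (Suc m * (2 * n + 1)) = x * z"
    "fps_X ^ (2 * m + 1) = y * fps_X" "fps_X ^ (2 * n + 2) = z * fps_X"
    unfolding x_def y_def z_def
    by (simp_all only: power_add[symmetric] power_Suc2[symmetric])
       (rule arg_cong[where f = "power fps_X"], simp add: algebra_simps)+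
  have I: "(1 - z) * I = 1"
    unfolding z_def I_def by (rule inverse_one_minus_X_power) simp
  have P: "gauss_prod (Suc n) = gauss_prod n * ((1 - z * fps_X) * I)"
    unfolding gauss_prod_Suc pw I_def ..
  have double: "2 * Suc m = 2 * m + 2" by simp
  have U: "(1 - fps_X ^ (2 * Suc m)) * inverse (gauss_prod (Suc m)) = (1 - y * fps_X) * R"
    unfolding double inverse_gauss_prod_Suc pw(3) R_def ..
  have "gauss_prod n * I * (x * ((1 - y) * R)) +
      (gauss_prod (Suc n) * R * (x * y) - gauss_prod n * R * x) =
      gauss_prod n * I * (x * z * ((1 - y * fps_X) * R))"
  proof -
    \<comment> \<open>Inserting \<open>(1 - z) * I = 1\<close> gives all terms the common factor
      \<open>gauss_prod n * I * R * x\<close>. What remains, with X for \<open>fps_X\<close>, is (1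
      - y) + (1 - z X) y - (1 - z) = z (1 - y X).\<close>
    have "gauss_prod n * R * x = gauss_prod n * R * x * ((1 - z) * I)"
      by (simp add: I)
    then show ?thesis unfolding P by (simp add: algebra_simps)
  qed
  then show ?case
    using Suc.IH unfolding sum.lessThan_Suc U pw
    by (simp only: I_def R_def x_def y_def)
qed simp

text \<open>From \<open>n\<close> to \<open>Suc n\<close> the left side gains the triangular numbers
  of index 2n and 2n + 1. The second is the telescoped boundary term, the first is the term s = n
  that the sum for \<open>n\<close> omits.\<close>

lemma shanks_identity:
  "(\<Sum>s<2 * n. fps_X ^ (s * (s + 1) div 2)) =
   (\<Sum>s<n. gauss_prod n * inverse (gauss_prod s) * fps_X ^ (s * (2 * n + 1)))"
proof (induction n)
  case (Suc n)
  have tri: "2 * n * (2 * n + 1) div 2 = n * (2 * n + 1)"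
    "Suc (2 * n) * (Suc (2 * n) + 1) div 2 = Suc n * (2 * n + 1)"
    by (simp_all add: algebra_simps)
  have "(\<Sum>s<Suc n. gauss_prod (Suc n) * inverse (gauss_prod s) * fps_X ^ (s * (2 * n + 3))) -
      (\<Sum>s<Suc n. gauss_prod n * inverse (gauss_prod s) * fps_X ^ (s * (2 * n + 1))) =
      gauss_prod n * inverse (1 - fps_X ^ (2 * n + 1)) *
       (fps_X ^ (Suc n * (2 * n + 1)) * ((1 - fps_X ^ (2 * Suc n)) * inverse (gauss_prod (Suc n))))"
    unfolding sum_subtractf[symmetric] by (rule shanks_telescope)
  \<comment> \<open>The factors in front and \<open>1 - fps_X ^ (2 * Suc n)\<close> assemble to
    \<open>gauss_prod (Suc n)\<close>, which cancels its inverse.\<close>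
  also have "\<dots> = fps_X ^ (Suc n * (2 * n + 1)) *
      (gauss_prod (Suc n) * inverse (gauss_prod (Suc n)))"
    unfolding gauss_prod_Suc[of n] by (simp add: mult_ac)
  finally have step: "(\<Sum>s<Suc n. gauss_prod (Suc n) * inverse (gauss_prod s) * fps_X ^ (s * (2 * n + 3))) =
      (\<Sum>s<Suc n. gauss_prod n * inverse (gauss_prod s) * fps_X ^ (s * (2 * n + 1))) +
      fps_X ^ (Suc n * (2 * n + 1))"
    by (simp add: gauss_prod_inverse diff_eq_eq add.commute)
  have last: "gauss_prod n * inverse (gauss_prod n) * fps_X ^ k = fps_X ^ k" for k
    by (simp add: gauss_prod_inverse)
  have "(\<Sum>s<2 * Suc n. fps_X ^ (s * (s + 1) div 2) :: real fps) =
      (\<Sum>s<2 * n. fps_X ^ (s * (s + 1) div 2)) + fps_X ^ (n * (2 * n + 1)) +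
      fps_X ^ (Suc n * (2 * n + 1))"
    unfolding tri[symmetric] by simp
  also have "\<dots> = (\<Sum>s<Suc n. gauss_prod (Suc n) * inverse (gauss_prod s) * fps_X ^ (s * (2 * n + 3)))"
    unfolding Suc.IH step by (simp only: sum.lessThan_Suc last)
  also have "2 * n + 3 = 2 * Suc n + 1" by simp
  finally show ?case .
qed simp

text \<open>In \<open>shanks_identity\<close> the terms with s \<ge> 1 start at degree 2n + 1 or
  later. Up to degree 2n only s = 0 survives, so \<open>gauss_prod n\<close> agrees there with a sum
  of powers of \<open>fps_X\<close>.\<close>

lemma gauss_prod_nth_nonneg:
  assumes "i \<le> 2 * n"
  shows "0 \<le> gauss_prod n $ i"
proof (cases n)
  \<comment> \<open>The sum is empty for n = 0, so there is no term s = 0 to isolate.\<close>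
  case 0
  then show ?thesis by (simp add: fps_one_nth)
next
  case (Suc m)
  let ?f = "\<lambda>s. gauss_prod n * inverse (gauss_prod s) * fps_X ^ (s * (2 * n + 1))"
  have "?f (Suc s) $ i = 0" for s
  proof -
    have "i < Suc s * (2 * n + 1)" using assms by simp
    then show ?thesis by (simp only: fps_X_power_mult_right_nth if_True)
  qed
  then have "(\<Sum>s<n. ?f s) $ i = gauss_prod n $ i"
    unfolding Suc sum.lessThan_Suc_shift by (simp add: fps_sum_nth)
  then have "gauss_prod n $ i = (\<Sum>s<2 * n. fps_X ^ (s * (s + 1) div 2)) $ i"
    unfolding shanks_identity by simp
  also have "\<dots> \<ge> 0"
    unfolding fps_sum_nth by (intro sum_nonneg) (simp add: fps_X_power_nth)
  finally show ?thesis .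
qed

subsection \<open>Generating functions of partitions with bounded parts\<close>

definition bounded_partitions :: "nat \<Rightarrow> nat \<Rightarrow> nat list set" where
  "bounded_partitions k n = {p \<in> partitions n. \<forall>x\<in>set p. x \<le> k}"

lemma finite_bounded_partitions [simp]: "finite (bounded_partitions k n)"
  unfolding bounded_partitions_def using finite_partitions by simp

lemma bounded_partitions_eq_partitions:
  assumes "n \<le> k"
  shows "bounded_partitions k n = partitions n"
  using assms member_le_sum_list
  unfolding bounded_partitions_def partitions_def by fastforce

lemma bounded_partitions_0: "bounded_partitions 0 n = (if n = 0 then {[]} else {})"
proof -
  have "p \<in> bounded_partitions 0 n \<longleftrightarrow> p = [] \<and> n = 0" for p
    unfolding bounded_partitions_def partitions_def by (cases p) auto
  then show ?thesis by auto
qed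

lemma Cons_in_bounded_partitions_iff:
  assumes "0 < k"
  shows "k # r \<in> bounded_partitions k n \<longleftrightarrow> k \<le> n \<and> r \<in> bounded_partitions k (n - k)"
  using assms unfolding bounded_partitions_def partitions_def by auto

text \<open>Parts are non-increasing, so the maximal admissible part, if it occurs at all, is the
  head.\<close>

lemma bounded_partitions_cases:
  assumes "p \<in> bounded_partitions (Suc k) n"
  obtains "p \<in> bounded_partitions k n" | r where "p = Suc k # r"
proof (cases "Suc k \<in> set p")
  case True
  then obtain a r where p: "p = a # r" by (cases p) auto
  have "a \<le> Suc k" "\<forall>x\<in>set r. x \<le> a"
    using assms unfolding p bounded_partitions_def partitions_def by simp_all
  then have "a = Suc k"
    using True unfolding p by auto
  then show ?thesis using p that(2) by blast
next
  case False
  have "x \<le> k" if "x \<in> set p" for x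
  proof -
    have "x \<le> Suc k" using assms that unfolding bounded_partitions_def by blast
    moreover have "x \<noteq> Suc k" using False that by blast
    ultimately show ?thesis by simp
  qed
  then show ?thesis
    using assms that(1) unfolding bounded_partitions_def by blast
qed

text \<open>Removing one copy of the part \<open>Suc k\<close> leaves parts that may again equal
  \<open>Suc k\<close>; hence the same bound reappears on the right.\<close>

lemma bounded_partitions_Suc:
  "bounded_partitions (Suc k) n = bounded_partitions k n \<union>
     (if Suc k \<le> n then Cons (Suc k) ` bounded_partitions (Suc k) (n - Suc k) else {})"
  (is "?L = ?R")
proof
  show "?L \<subseteq> ?R"
  proof
    fix p assume p: "p \<in> ?L"
    then show "p \<in> ?R"
      by (cases rule: bounded_partitions_cases) (use p in \<open>auto simp: Cons_in_bounded_partitions_iff\<close>)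
  qed
  have "bounded_partitions k n \<subseteq> ?L"
    unfolding bounded_partitions_def using le_SucI by blast
  moreover have "Cons (Suc k) ` bounded_partitions (Suc k) (n - Suc k) \<subseteq> ?L" if "Suc k \<le> n"
    using that by (auto simp: Cons_in_bounded_partitions_iff)
  ultimately show "?R \<subseteq> ?L" by simp
qed

text \<open>The weight is a parameter so that counting partitions and summing signed parts obey one
  recursion.\<close>

definition partition_fps :: "nat \<Rightarrow> (nat list \<Rightarrow> real) \<Rightarrow> real fps" where
  "partition_fps k g = Abs_fps (\<lambda>n. \<Sum>p\<in>bounded_partitions k n. g p)"

lemma partition_fps_Suc:
  "partition_fps (Suc k) g =
     partition_fps k g + fps_X ^ Suc k * partition_fps (Suc k) (\<lambda>p. g (Suc k # p))"
proof (rule fps_ext)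
  fix n
  have disj: "bounded_partitions k n \<inter> Cons (Suc k) ` A = {}" for A
    unfolding bounded_partitions_def by auto
  show "partition_fps (Suc k) g $ n =
    (partition_fps k g + fps_X ^ Suc k * partition_fps (Suc k) (\<lambda>p. g (Suc k # p))) $ n"
  proof (cases "Suc k \<le> n")
    case True
    let ?B = "bounded_partitions (Suc k) (n - Suc k)"
    have "sum g (bounded_partitions (Suc k) n) =
        sum g (bounded_partitions k n) + sum g (Cons (Suc k) ` ?B)"
      unfolding bounded_partitions_Suc[of k n] if_P[OF True]
      by (rule sum.union_disjoint) (simp_all add: disj)
    also have "sum g (Cons (Suc k) ` ?B) = (\<Sum>p\<in>?B. g (Suc k # p))"
      by (subst sum.reindex) (simp_all add: o_def)
    finally show ?thesis
      using True by (simp add: partition_fps_def fps_X_power_mult_nth del: power_Suc)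
  next
    case False
    have "bounded_partitions (Suc k) n = bounded_partitions k n"
      unfolding bounded_partitions_Suc[of k n] if_not_P[OF False] by (rule Un_empty_right)
    then have "partition_fps (Suc k) g $ n = partition_fps k g $ n"
      unfolding partition_fps_def by simp
    moreover have "(fps_X ^ Suc k * f) $ n = 0" for f :: "real fps"
      using False by (simp only: fps_X_power_mult_nth not_le if_True)
    ultimately show ?thesis by (simp only: fps_add_nth add_0_right)
  qed
qed

definition count_fps :: "nat \<Rightarrow> real fps" where
  "count_fps k = partition_fps k (\<lambda>_. 1)"

definition odd_minus_even :: "nat list \<Rightarrow> real" where
  "odd_minus_even p = real (sum_list (filter odd p)) - real (sum_list (filter even p))"

definition some_fps :: "nat \<Rightarrow> real fps" where
  "some_fps k = partition_fps k odd_minus_even"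

lemma count_fps_0: "count_fps 0 = 1"
  by (rule fps_ext) (simp add: count_fps_def partition_fps_def bounded_partitions_0 fps_one_nth)

lemma some_fps_0: "some_fps 0 = 0"
  by (rule fps_ext)
     (simp add: some_fps_def partition_fps_def bounded_partitions_0 odd_minus_even_def)

lemma count_fps_Suc: "(1 - fps_X ^ Suc k) * count_fps (Suc k) = count_fps k"
  unfolding count_fps_def left_diff_distrib mult_1_left diff_eq_eq by (rule partition_fps_Suc)

text \<open>\<open>odd_minus_even\<close> is additive, so each extra part \<open>Suc k\<close>
  contributes the constant \<open>c\<close>, once per partition. Iterated, this recursion encodes
  the Lambert-type sum.\<close>

lemma some_fps_Suc:
  fixes k :: nat
  defines "c \<equiv> (if odd (Suc k) then real (Suc k) else - real (Suc k))"
  shows "(1 - fps_X ^ Suc k) * some_fps (Suc k) =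
    some_fps k + fps_const c * fps_X ^ Suc k * count_fps (Suc k)"
proof -
  have "odd_minus_even (Suc k # p) = c + odd_minus_even p" for p
    by (simp add: odd_minus_even_def c_def)
  then have "partition_fps (Suc k) (\<lambda>p. odd_minus_even (Suc k # p)) =
      fps_const c * count_fps (Suc k) + some_fps (Suc k)"
    by (intro fps_ext)
       (simp add: partition_fps_def count_fps_def some_fps_def sum.distrib)
  with partition_fps_Suc[of k odd_minus_even] show ?thesis
    by (simp add: some_fps_def algebra_simps del: power_Suc)
qed

lemma some_parts_eq_some_fps:
  assumes "n \<le> k"
  shows "real_of_int (some_parts n) = some_fps k $ n"
  by (simp add: some_parts_def some_fps_def partition_fps_def
      bounded_partitions_eq_partitions[OF assms] odd_minus_even_def sum_subtractf)

subsection \<open>Factorisation of the generating function\<close>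

definition even_square_fps :: "nat \<Rightarrow> real fps" where
  "even_square_fps n = (\<Prod>s<n. inverse (1 - fps_X ^ (2 * s + 2)) ^ 2)"

lemma even_square_fps_Suc:
  "(1 - fps_X ^ (2 * n + 2)) ^ 2 * even_square_fps (Suc n) = even_square_fps n"
proof -
  have "(1 - fps_X ^ (2 * n + 2)) ^ 2 * even_square_fps (Suc n) =
      even_square_fps n * ((1 - fps_X ^ (2 * n + 2)) * inverse (1 - fps_X ^ (2 * n + 2))) ^ 2"
    by (simp only: even_square_fps_def prod.lessThan_Suc power_mult_distrib mult_ac)
  then show ?thesis by (subst (asm) inverse_one_minus_X_power) simp_all
qed

text \<open>The factor s = 0 is the square of \<open>inverse (1 - fps_X ^ 2)\<close>; one copy
  cancels against \<open>1 - fps_X ^ 2\<close>, and the other factors are geometric series.\<close>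

lemma nonneg_even_square_fps: "nonneg_fps ((1 - fps_X ^ 2) * even_square_fps (Suc n))"
proof -
  let ?i = "\<lambda>k. inverse (1 - fps_X ^ k) :: real fps"
  have "even_square_fps (Suc n) = ?i 2 ^ 2 * (\<Prod>s<n. ?i (2 * Suc s + 2) ^ 2)"
    unfolding even_square_fps_def by (subst prod.lessThan_Suc_shift) (simp only: mult_0_right add_0)
  then have "(1 - fps_X ^ 2) * even_square_fps (Suc n) =
      ((1 - fps_X ^ 2) * ?i 2) * (?i 2 * (\<Prod>s<n. ?i (2 * Suc s + 2) ^ 2))"
    by (simp only: power2_eq_square[of "?i 2"] mult_ac)
  also have "\<dots> = ?i 2 * (\<Prod>s<n. ?i (2 * Suc s + 2) ^ 2)"
    by (subst inverse_one_minus_X_power) simp_all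
  also have "nonneg_fps \<dots>"
  proof (rule nonneg_fps_mult[OF _ nonneg_fps_prod])
    have i: "nonneg_fps (?i k)" if "0 < k" for k
      using that by (rule nonneg_fps_inverse_one_minus_X_power)
    show "nonneg_fps (?i 2)" by (rule i) simp
    show "nonneg_fps (?i (2 * Suc s + 2) ^ 2)" for s
      unfolding power2_eq_square[of "?i (2 * Suc s + 2)"] by (intro nonneg_fps_mult i) simp_all
  qed
  finally show ?thesis .
qed

lemma one_minus_X_power_neq_0: "0 < k \<Longrightarrow> (1 - fps_X ^ k :: real fps) \<noteq> 0"
  using inverse_one_minus_X_power[of k] by auto

text \<open>The new parts 2n + 1 and 2n + 2 contribute 1 / (a b) = (1 / b^2) (b / a). The induction
  works with cross-multiplied equations and cancels \<open>a * b\<close> at the end.\<close>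

lemma count_fps_factor: "count_fps (2 * n) = even_square_fps n * gauss_prod n"
proof (induction n)
  case 0
  then show ?case by (simp add: count_fps_0 even_square_fps_def)
next
  case (Suc n)
  define a b :: "real fps" where "a = 1 - fps_X ^ (2 * n + 1)" and "b = 1 - fps_X ^ (2 * n + 2)"
  have "b * count_fps (2 * Suc n) = count_fps (2 * n + 1)"
    using count_fps_Suc[of "2 * n + 1"] by (simp add: b_def del: power_Suc)
  moreover have "a * count_fps (2 * n + 1) = count_fps (2 * n)"
    using count_fps_Suc[of "2 * n"] by (simp add: a_def del: power_Suc)
  ultimately have "a * b * count_fps (2 * Suc n) = count_fps (2 * n)"
    by (simp only: mult.assoc)
  also have "\<dots> = b ^ 2 * even_square_fps (Suc n) * gauss_prod n"
    unfolding Suc.IH b_def even_square_fps_Suc ..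
  also have "\<dots> = b * even_square_fps (Suc n) * (b * gauss_prod n)"
    by (simp add: power2_eq_square mult_ac)
  also have "b * gauss_prod n = a * gauss_prod (Suc n)"
    unfolding a_def b_def gauss_prod_Suc_mult ..
  finally have "a * b * count_fps (2 * Suc n) =
      a * b * (even_square_fps (Suc n) * gauss_prod (Suc n))"
    by (simp add: mult_ac)
  moreover have "a \<noteq> 0" "b \<noteq> 0"
    unfolding a_def b_def by (rule one_minus_X_power_neq_0; simp)+
  ultimately show ?case by simp
qed

lemma X_mult_deriv_nth: "(fps_X * fps_deriv f) $ n = real n * f $ n"
  by (cases n) simp_all

lemma X_mult_deriv_one_minus_X_power:
  "fps_X * fps_deriv (1 - fps_X ^ k) = - (of_nat k * fps_X ^ k :: real fps)"
  by (rule fps_ext)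
     (simp add: X_mult_deriv_nth fps_X_power_nth fps_one_nth fps_of_nat[symmetric])

text \<open>Induction replaces the logarithmic derivative of an infinite product:
  \<open>fps_X * fps_deriv\<close> is a derivation, so applied to the recurrence of
  \<open>gauss_prod\<close> it yields the same recursion as adding the parts 2n + 1 and 2n +
  2.\<close>

lemma some_fps_factor:
  "some_fps (2 * n) = even_square_fps n * (fps_X * fps_deriv (gauss_prod n))"
proof (induction n)
  case 0
  then show ?case by (simp add: some_fps_0)
next
  case (Suc n)
  define u v :: "real fps" where "u = fps_X ^ (2 * n + 1)" and "v = fps_X ^ (2 * n + 2)"
  define c d :: "real fps" where "c = of_nat (2 * n + 1)" and "d = of_nat (2 * n + 2)"
  define D where "D m = fps_X * fps_deriv (gauss_prod m)" for m
  define E where "E = even_square_fps (Suc n)"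
  define P where "P = gauss_prod (Suc n)"
  define W1 W2 where "W1 = some_fps (2 * n + 1)" and "W2 = some_fps (2 * Suc n)"
  have P: "(1 - u) * P = (1 - v) * gauss_prod n"
    unfolding u_def v_def P_def by (rule gauss_prod_Suc_mult)
  have deriv: "fps_X * fps_deriv (1 - u) = - (c * u)" "fps_X * fps_deriv (1 - v) = - (d * v)"
    unfolding u_def v_def c_def d_def by (rule X_mult_deriv_one_minus_X_power)+
  have leibniz: "fps_X * fps_deriv (f * g) =
      f * (fps_X * fps_deriv g) + (fps_X * fps_deriv f) * g" for f g :: "real fps"
    by (simp add: algebra_simps)
  have "fps_X * fps_deriv ((1 - u) * P) = fps_X * fps_deriv ((1 - v) * gauss_prod n)"
    by (simp only: P)
  then have D: "(1 - u) * D (Suc n) - c * u * P = (1 - v) * D n - d * v * gauss_prod n"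
    unfolding leibniz deriv by (simp add: D_def P_def)
  have C2: "count_fps (2 * Suc n) = E * P"
    unfolding E_def P_def by (rule count_fps_factor)
  then have C1: "count_fps (2 * n + 1) = (1 - v) * (E * P)"
    using count_fps_Suc[of "2 * n + 1"] by (simp add: v_def del: power_Suc)
  have W1: "(1 - u) * W1 = some_fps (2 * n) + c * u * ((1 - v) * (E * P))"
    using some_fps_Suc[of "2 * n"] C1
    by (simp add: u_def c_def W1_def fps_of_nat[symmetric] add.commute del: power_Suc)
  \<comment> \<open>The part 2n + 2 is even and enters with a minus sign, whereas 2n + 1 entered
    \<open>W1\<close> with a plus.\<close>
  have W2: "(1 - v) * W2 = W1 - d * v * (E * P)"
  proof -
    have "fps_const (if odd (Suc (2 * n + 1)) then real (Suc (2 * n + 1))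
        else - real (Suc (2 * n + 1))) = - d"
      by (simp add: d_def fps_of_nat[symmetric])
    note some_fps_Suc[of "2 * n + 1", unfolded this]
    then show ?thesis using C2 by (simp add: v_def W1_def W2_def del: power_Suc)
  qed
  have "(1 - u) * (1 - v) * W2 = (1 - u) * ((1 - v) * W2)"
    by (simp only: mult.assoc)
  also have "\<dots> = (1 - u) * W1 - d * v * E * ((1 - u) * P)"
    unfolding W2 by (simp add: algebra_simps)
  also have "\<dots> = (1 - v)\<^sup>2 * E * D n + c * u * ((1 - v) * (E * P)) - d * v * E * ((1 - v) * gauss_prod n)"
    unfolding W1 P Suc.IH using even_square_fps_Suc[of n] by (simp add: v_def E_def D_def del: power_Suc)
  \<comment> \<open>By \<open>D\<close>, the last bracket equals
    \<open>(1 - u) * D (Suc n)\<close>.\<close>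
  also have "\<dots> = (1 - v) * E * ((1 - v) * D n - d * v * gauss_prod n + c * u * P)"
    by (simp add: algebra_simps power2_eq_square)
  also have "\<dots> = (1 - u) * (1 - v) * (E * D (Suc n))"
    unfolding D[symmetric] by (simp add: algebra_simps)
  finally have "(1 - u) * (1 - v) * W2 = (1 - u) * (1 - v) * (E * D (Suc n))" .
  moreover have "1 - u \<noteq> 0" "1 - v \<noteq> 0"
    unfolding u_def v_def by (rule one_minus_X_power_neq_0; simp)+
  ultimately show ?case by (simp add: W2_def E_def D_def)
qed

section \<open>Monotonicity in steps of two\<close>

lemma some_parts_le_add_2: "some_parts n \<le> some_parts (n + 2)"
proof -
  \<comment> \<open>The bound 2n + 2 is at least n + 2, so the coefficients at n and n + 2 are the
    true values; multiplying by \<open>1 - fps_X ^ 2\<close> turns the coefficient at n + 2 into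
    their difference.\<close>
  let ?f = "some_fps (2 * Suc n)"
  have "((1 - fps_X ^ 2) * ?f) $ (n + 2) =
      (((1 - fps_X ^ 2) * even_square_fps (Suc n)) * (fps_X * fps_deriv (gauss_prod (Suc n)))) $ (n + 2)"
    by (simp only: some_fps_factor mult.assoc)
  also have "\<dots> \<ge> 0"
    unfolding fps_mult_nth[of "(1 - fps_X ^ 2) * even_square_fps (Suc n)"]
  proof (intro sum_nonneg mult_nonneg_nonneg)
    fix i
    show "0 \<le> ((1 - fps_X ^ 2) * even_square_fps (Suc n)) $ i"
      using nonneg_even_square_fps unfolding nonneg_fps_def by blast
    \<comment> \<open>Nonnegativity of \<open>gauss_prod (Suc n)\<close> is available only up to
      degree 2n + 2, which covers every index n + 2 - i of this convolution.\<close>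
    show "0 \<le> (fps_X * fps_deriv (gauss_prod (Suc n))) $ (n + 2 - i)"
      using gauss_prod_nth_nonneg[of "n + 2 - i" "Suc n"]
      unfolding X_mult_deriv_nth by (intro mult_nonneg_nonneg) simp_all
  qed
  finally have "?f $ n \<le> ?f $ (n + 2)"
    by (simp add: left_diff_distrib fps_X_power_mult_nth)
  then have "real_of_int (some_parts n) \<le> real_of_int (some_parts (n + 2))"
    using some_parts_eq_some_fps[of n "2 * Suc n"] some_parts_eq_some_fps[of "n + 2" "2 * Suc n"] by simp
  then show ?thesis by simp
qed

theorem corollary3p10:
  shows "mono_on {1::nat..} (\<lambda>n. some_parts (2 * n)) \<and>
         mono_on {1::nat..} (\<lambda>n. some_parts (2 * n - 1))"
proof -
  have mono: "some_parts m \<le> some_parts (m + 2 * k)" for m k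
  proof (induction k)
    case (Suc k)
    then show ?case using some_parts_le_add_2[of "m + 2 * k"] by simp
  qed simp
  show ?thesis
  proof (intro conjI mono_onI)
    fix r s :: nat
    assume rs: "r \<in> {1..}" "r \<le> s"
    \<comment> \<open>Since r \<ge> 1, the natural subtraction in \<open>2 * r - 1\<close> is
      exact.\<close>
    then have eq: "2 * s = 2 * r + 2 * (s - r)" "2 * s - 1 = (2 * r - 1) + 2 * (s - r)"
      by auto
    show "some_parts (2 * r) \<le> some_parts (2 * s)" unfolding eq(1) by (rule mono)
    show "some_parts (2 * r - 1) \<le> some_parts (2 * s - 1)" unfolding eq(2) by (rule mono)
  qed
qed

end
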